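(* Let $m,n,d\ge1$ be integers with $m>n$ and $m\ge n+d$. Let $A=A_0+A_1\mathbf{i}+A_2\mathbf{j}+A_3\mathbf{k}\in\mathbb{Q}_{\mathbb{R}}^{m\times n}$ and $B=B_0+B_1\mathbf{i}+B_2\mathbf{j}+B_3\mathbf{k}\in\mathbb{Q}_{\mathbb{R}}^{m\times d}$ (components real matrices), and put $C=[A_0^T,A_1^T,A_2^T,A_3^T]^T\in\mathbb{R}^{4m\times n}$, $D=[B_0^T,B_1^T,B_2^T,B_3^T]^T\in\mathbb{R}^{4m\times d}$. Let $X\in\mathbb{R}^{n\times d}$ be a real matrix. Then $X$ is an RBLS solution (for $A,B$) if and only if $X$ is a solution of the real least squares problem $\min_{X\in\mathbb{R}^{n\times d}}\|CX-D\|_F$. In this case, the solutions are given by $$X=C^{+}D+(I-C^{+}C)Z,$$ where $Z\in\mathbb{R}^{n\times d}$ is an arbitrary matrix, and the solution with the least (Frobenius) norm is $X=C^{+}D$.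
   Context: Reduced biquaternions: $\mathbb{Q}_{\mathbb{R}}$ is the commutative real algebra of elements $a=a_0+a_1\mathbf{i}+a_2\mathbf{j}+a_3\mathbf{k}$ ($a_t\in\mathbb{R}$) with $\mathbf{i}^2=\mathbf{k}^2=-1$, $\mathbf{j}^2=1$, $\mathbf{i}\mathbf{j}=\mathbf{j}\mathbf{i}=\mathbf{k}$, $\mathbf{j}\mathbf{k}=\mathbf{k}\mathbf{j}=\mathbf{i}$, $\mathbf{k}\mathbf{i}=\mathbf{i}\mathbf{k}=-\mathbf{j}$. The norm is $\|a\|=\sqrt{a_0^2+a_1^2+a_2^2+a_3^2}$, and for $M=(m_{ij})$ over $\mathbb{Q}_{\mathbb{R}}$, $\|M\|_F=\big(\sum_{i,j}\|m_{ij}\|^2\big)^{1/2}$. Real matrices are viewed as matrices over $\mathbb{Q}_{\mathbb{R}}$. $C^{+}$ denotes the Moore–Penrose inverse of $C$. RBLS problem (unknown $X$ real): minimize $\|\widehat G\|_F$ over $X\in\mathbb{R}^{n\times d}$ and $\widehat G\in\mathbb{Q}_{\mathbb{R}}^{m\times d}$ subject to $AX=B+\widehat G$. An RBLS solution is a real $X$ for which there is $\widehat G$ such that $(X,\widehat G)$ is feasible and attains the minimum. *)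

theory Defs
  imports "HOL-Analysis.Analysis"
begin

section \<open>Reduced biquaternions\<close>

text \<open>
  The element \<open>RBiq a\<^sub>0 a\<^sub>1 a\<^sub>2 a\<^sub>3\<close> stands for \<open>a\<^sub>0 + a\<^sub>1 i + a\<^sub>2 j + a\<^sub>3 k\<close>. As for the complex
  numbers in the distribution, a codatatype is used only to have component-wise
  definitions by \<open>primcorec\<close>.
\<close>

codatatype rbiq = RBiq (Rb0: real) (Rb1: real) (Rb2: real) (Rb3: real)

lemma rbiq_eq_iff:
  "x = y \<longleftrightarrow> Rb0 x = Rb0 y \<and> Rb1 x = Rb1 y \<and> Rb2 x = Rb2 y \<and> Rb3 x = Rb3 y"
  by (auto intro: rbiq.expand)

instantiation rbiq :: comm_ring_1
begin

primcorec zero_rbiq where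
  "Rb0 0 = 0" | "Rb1 0 = 0" | "Rb2 0 = 0" | "Rb3 0 = 0"

primcorec one_rbiq where
  "Rb0 1 = 1" | "Rb1 1 = 0" | "Rb2 1 = 0" | "Rb3 1 = 0"

primcorec plus_rbiq where
  "Rb0 (x + y) = Rb0 x + Rb0 y"
| "Rb1 (x + y) = Rb1 x + Rb1 y"
| "Rb2 (x + y) = Rb2 x + Rb2 y"
| "Rb3 (x + y) = Rb3 x + Rb3 y"

primcorec uminus_rbiq where
  "Rb0 (- x) = - Rb0 x"
| "Rb1 (- x) = - Rb1 x"
| "Rb2 (- x) = - Rb2 x"
| "Rb3 (- x) = - Rb3 x"

primcorec minus_rbiq where
  "Rb0 (x - y) = Rb0 x - Rb0 y"
| "Rb1 (x - y) = Rb1 x - Rb1 y"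
| "Rb2 (x - y) = Rb2 x - Rb2 y"
| "Rb3 (x - y) = Rb3 x - Rb3 y"

text \<open>
  The bilinear extension of the multiplication table of \<open>i\<close>, \<open>j\<close>, \<open>k\<close>; the table itself is
  recovered in \<open>rb_unit_table\<close> below.
\<close>

primcorec times_rbiq where
  "Rb0 (x * y) = Rb0 x * Rb0 y - Rb1 x * Rb1 y + Rb2 x * Rb2 y - Rb3 x * Rb3 y"
| "Rb1 (x * y) = Rb0 x * Rb1 y + Rb1 x * Rb0 y + Rb2 x * Rb3 y + Rb3 x * Rb2 y"
| "Rb2 (x * y) = Rb0 x * Rb2 y + Rb2 x * Rb0 y - Rb1 x * Rb3 y - Rb3 x * Rb1 y"
| "Rb3 (x * y) = Rb0 x * Rb3 y + Rb3 x * Rb0 y + Rb1 x * Rb2 y + Rb2 x * Rb1 y"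

instance
  by standard (simp_all add: rbiq_eq_iff algebra_simps)

end

instantiation rbiq :: real_algebra_1
begin

primcorec scaleR_rbiq where
  "Rb0 (scaleR r x) = r * Rb0 x"
| "Rb1 (scaleR r x) = r * Rb1 x"
| "Rb2 (scaleR r x) = r * Rb2 x"
| "Rb3 (scaleR r x) = r * Rb3 x"

instance
  by standard (simp_all add: rbiq_eq_iff algebra_simps)

end

instantiation rbiq :: real_inner
begin

definition inner_rbiq :: "rbiq \<Rightarrow> rbiq \<Rightarrow> real" where
  "inner_rbiq x y = Rb0 x * Rb0 y + Rb1 x * Rb1 y + Rb2 x * Rb2 y + Rb3 x * Rb3 y"

definition norm_rbiq :: "rbiq \<Rightarrow> real" where
  "norm_rbiq x = sqrt ((Rb0 x)\<^sup>2 + (Rb1 x)\<^sup>2 + (Rb2 x)\<^sup>2 + (Rb3 x)\<^sup>2)"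

definition sgn_rbiq :: "rbiq \<Rightarrow> rbiq" where
  "sgn_rbiq x = x /\<^sub>R norm x"

definition dist_rbiq :: "rbiq \<Rightarrow> rbiq \<Rightarrow> real" where
  "dist_rbiq x y = norm (x - y)"

definition uniformity_rbiq :: "(rbiq \<times> rbiq) filter" where
  "uniformity_rbiq = (INF e\<in>{0<..}. principal {(x, y). dist x y < e})"

definition open_rbiq :: "rbiq set \<Rightarrow> bool" where
  "open_rbiq U \<longleftrightarrow> (\<forall>x\<in>U. eventually (\<lambda>(x', y). x' = x \<longrightarrow> y \<in> U) uniformity)"

instance
proof
  fix x y z :: rbiq and r :: real
  show "inner x x = 0 \<longleftrightarrow> x = 0"
    unfolding inner_rbiq_def rbiq_eq_iff zero_rbiq.sel
    by (smt (verit) mult_eq_0_iff not_real_square_gt_zero)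
qed (simp_all add: inner_rbiq_def norm_rbiq_def sgn_rbiq_def dist_rbiq_def uniformity_rbiq_def
      open_rbiq_def algebra_simps power2_eq_square)

end

definition rb_i :: rbiq where "rb_i = RBiq 0 1 0 0"
definition rb_j :: rbiq where "rb_j = RBiq 0 0 1 0"
definition rb_k :: rbiq where "rb_k = RBiq 0 0 0 1"

lemma rb_unit_table:
  "rb_i * rb_i = - 1" "rb_k * rb_k = - 1" "rb_j * rb_j = 1"
  "rb_i * rb_j = rb_k" "rb_j * rb_i = rb_k"
  "rb_j * rb_k = rb_i" "rb_k * rb_j = rb_i"
  "rb_k * rb_i = - rb_j" "rb_i * rb_k = - rb_j"
  by (simp_all add: rbiq_eq_iff rb_i_def rb_j_def rb_k_def)

lemma rbiq_sel_of_real [simp]: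
  "Rb0 (of_real r) = r" "Rb1 (of_real r) = 0" "Rb2 (of_real r) = 0" "Rb3 (of_real r) = 0"
  by (simp_all add: of_real_def)

lemma rbiq_expansion:
  "a = of_real (Rb0 a) + of_real (Rb1 a) * rb_i + of_real (Rb2 a) * rb_j + of_real (Rb3 a) * rb_k"
  by (simp add: rbiq_eq_iff rb_i_def rb_j_def rb_k_def)

section \<open>Matrices\<close>

definition frobenius_norm :: "'a::real_normed_vector^'n^'m \<Rightarrow> real" where
  "frobenius_norm M = sqrt (\<Sum>i\<in>UNIV. \<Sum>j\<in>UNIV. (norm (M $ i $ j))\<^sup>2)"

text \<open>
  Vertical concatenation; the rows of the result are indexed by the disjoint sum of the
  row indices.
\<close>

definition vstack :: "'a^'n^'k \<Rightarrow> 'a^'n^'l \<Rightarrow> 'a^'n^('k + 'l)" where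
  "vstack M N = (\<chi> r. case r of Inl i \<Rightarrow> M $ i | Inr i \<Rightarrow> N $ i)"

definition rb_stack :: "rbiq^'n^'m \<Rightarrow> real^'n^('m + 'm + 'm + 'm)" where
  "rb_stack A =
     vstack (map_matrix Rb0 A)
       (vstack (map_matrix Rb1 A) (vstack (map_matrix Rb2 A) (map_matrix Rb3 A)))"

definition is_moore_penrose_inverse :: "real^'n^'m \<Rightarrow> real^'m^'n \<Rightarrow> bool" where
  "is_moore_penrose_inverse M P \<longleftrightarrow>
     M ** P ** M = M \<and> P ** M ** P = P \<and>
     transpose (M ** P) = M ** P \<and> transpose (P ** M) = P ** M"

lemma is_moore_penrose_inverse_unique:
  assumes "is_moore_penrose_inverse M P" "is_moore_penrose_inverse M Q"
  shows "P = Q"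
proof -
  have MP: "M ** P = M ** Q"
  proof -
    have "M ** P = transpose (M ** Q ** (M ** P))"
      using assms unfolding is_moore_penrose_inverse_def by (metis matrix_mul_assoc)
    also have "\<dots> = M ** P ** (M ** Q)"
      using assms unfolding is_moore_penrose_inverse_def by (metis matrix_transpose_mul)
    also have "\<dots> = M ** Q"
      using assms unfolding is_moore_penrose_inverse_def by (metis matrix_mul_assoc)
    finally show ?thesis .
  qed
  have PM: "P ** M = Q ** M"
  proof -
    have "P ** M = transpose (P ** M ** (Q ** M))"
      using assms unfolding is_moore_penrose_inverse_def by (metis matrix_mul_assoc)
    also have "\<dots> = Q ** M ** (P ** M)"
      using assms unfolding is_moore_penrose_inverse_def by (metis matrix_transpose_mul)
    also have "\<dots> = Q ** M"
      using assms unfolding is_moore_penrose_inverse_def by (metis matrix_mul_assoc)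
    finally show ?thesis .
  qed
  show ?thesis
    using assms MP PM unfolding is_moore_penrose_inverse_def by (metis matrix_mul_assoc)
qed

definition moore_penrose_inverse :: "real^'n^'m \<Rightarrow> real^'m^'n" where
  "moore_penrose_inverse M = (THE P. is_moore_penrose_inverse M P)"

section \<open>Least squares problems\<close>

definition rbls_feasible ::
  "rbiq^'n^'m \<Rightarrow> rbiq^'d^'m \<Rightarrow> real^'d^'n \<Rightarrow> rbiq^'d^'m \<Rightarrow> bool" where
  "rbls_feasible A B X G \<longleftrightarrow> A ** map_matrix of_real X = B + G"

definition is_rbls_solution :: "rbiq^'n^'m \<Rightarrow> rbiq^'d^'m \<Rightarrow> real^'d^'n \<Rightarrow> bool" where
  "is_rbls_solution A B X \<longleftrightarrow>
     (\<exists>G. rbls_feasible A B X G \<and>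
       (\<forall>X' G'. rbls_feasible A B X' G' \<longrightarrow> frobenius_norm G \<le> frobenius_norm G'))"

definition is_ls_solution :: "real^'n^'k \<Rightarrow> real^'d^'k \<Rightarrow> real^'d^'n \<Rightarrow> bool" where
  "is_ls_solution C D X \<longleftrightarrow>
     (\<forall>Y. frobenius_norm (C ** X - D) \<le> frobenius_norm (C ** Y - D))"

end

theory Submission
  imports Defs
begin

text \<open>
  Since \<open>X\<close> is real, the four components of \<open>A X - B\<close> are the blocks of \<open>C X - D\<close>, so both problems
  minimise the same function. For the real problem, the columns of \<open>C X - C C\<^sup>+ D\<close> are orthogonal to
  those of \<open>D - C C\<^sup>+ D\<close>, so by Pythagoras the minimisers are the solutions of \<open>C X = C C\<^sup>+ D\<close>; a
  second orthogonal splitting, \<open>X = C\<^sup>+ D + (I - C\<^sup>+ C) Z\<close>, shows that \<open>C\<^sup>+ D\<close> is the shortest of them.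
\<close>

lemma frobenius_norm_eq_norm: "frobenius_norm M = norm M"
  by (simp add: frobenius_norm_def norm_vec_def L2_set_def sum_nonneg)

text \<open>Transposition is the adjoint for the Frobenius inner product: both sides are the same
  triple sum, taken in a different order.\<close>

lemma inner_matrix_mult_left:
  fixes M :: "real^'n^'m" and X :: "real^'d^'n" and Y :: "real^'d^'m"
  shows "inner (M ** X) Y = inner X (transpose M ** Y)"
proof -
  have "inner (M ** X) Y = (\<Sum>i\<in>UNIV. \<Sum>j\<in>UNIV. \<Sum>k\<in>UNIV. M $ i $ k * X $ k $ j * Y $ i $ j)"
    by (simp add: inner_vec_def matrix_matrix_mult_def sum_distrib_right)
  also have "\<dots> = (\<Sum>i\<in>UNIV. \<Sum>k\<in>UNIV. \<Sum>j\<in>UNIV. M $ i $ k * X $ k $ j * Y $ i $ j)"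
    by (intro sum.cong refl sum.swap)
  also have "\<dots> = (\<Sum>k\<in>UNIV. \<Sum>i\<in>UNIV. \<Sum>j\<in>UNIV. M $ i $ k * X $ k $ j * Y $ i $ j)"
    by (rule sum.swap)
  also have "\<dots> = (\<Sum>k\<in>UNIV. \<Sum>j\<in>UNIV. \<Sum>i\<in>UNIV. M $ i $ k * X $ k $ j * Y $ i $ j)"
    by (intro sum.cong refl sum.swap)
  also have "\<dots> = inner X (transpose M ** Y)"
    by (simp add: inner_vec_def matrix_matrix_mult_def transpose_def sum_distrib_left mult_ac)
  finally show ?thesis .
qed

text \<open>Strictness lets one lemma yield both minimality and uniqueness of a minimiser.\<close>

lemma norm_add_Pythagorean_less:
  assumes "inner x y = 0" "y \<noteq> 0"
  shows "norm x < norm (x + y)"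
proof -
  have "(norm (x + y))\<^sup>2 = (norm x)\<^sup>2 + (norm y)\<^sup>2"
    using assms(1) by (intro norm_add_Pythagorean) (simp add: orthogonal_def)
  then have "(norm x)\<^sup>2 < (norm (x + y))\<^sup>2"
    using assms(2) by simp
  then show ?thesis
    by (rule power2_less_imp_less) simp
qed

text \<open>Project \<open>y\<close> orthogonally onto the range of \<open>M\<close>; a preimage of
  the projection is the required \<open>x\<close>.\<close>

lemma ex_normal_equation_solution:
  fixes M :: "real^'n^'m" and y :: "real^'m"
  shows "\<exists>x. transpose M *v (M *v x) = transpose M *v y"
proof -
  have "subspace (range ((*v) M))"
    by (simp add: linear_subspace_image)
  then obtain s t where s: "s \<in> range ((*v) M)"
    and t: "\<And>w. w \<in> range ((*v) M) \<Longrightarrow> orthogonal t w" and y: "y = s + t"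
    by (metis orthogonal_subspace_decomp_exists span_eq_iff)
  obtain x where x: "s = M *v x"
    using s by blast
  \<comment> \<open>The vector \<open>t\<close> is orthogonal to
    \<open>M *v (transpose M *v t)\<close>, which lies in the range; moving \<open>M\<close> across
    makes this a squared norm.\<close>
  have "inner (transpose M *v t) (transpose M *v t) = 0"
    using t[of "M *v (transpose M *v t)"]
    by (simp add: orthogonal_def dot_lmul_matrix)
  then show ?thesis
    using x y by (metis add.right_neutral inner_eq_zero_iff matrix_vector_right_distrib)
qed

text \<open>The digits are those of the Penrose conditions that \<open>G\<close> satisfies.\<close>

lemma ex_13_inverse:
  fixes M :: "real^'n^'m"
  shows "\<exists>G. M ** G ** M = M \<and> transpose (M ** G) = M ** G"
proof -
  obtain g where g: "\<And>y. transpose M *v (M *v g y) = transpose M *v y"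
    using ex_normal_equation_solution[of M] by metis
  \<comment> \<open>Column \<open>j\<close> of \<open>G\<close> solves the normal equation whose
    right-hand side is the \<open>j\<close>-th unit vector.\<close>
  define G :: "real^'m^'n" where "G = transpose (\<chi> j. g (axis j 1))"
  have "column j (transpose M ** (M ** G)) = column j (transpose M)" for j
  proof -
    have "G *v axis j 1 = g (axis j 1)"
      by (simp add: G_def matrix_vector_mult_basis column_transpose row_def)
    then show ?thesis
      by (simp add: g del: transpose_matrix_vector
          flip: matrix_vector_mult_basis matrix_vector_mul_assoc)
  qed
  then have normal: "transpose M ** (M ** G) = transpose M"
    by (simp add: column_def vec_eq_iff)
  \<comment> \<open>The left side is symmetric whatever \<open>G\<close> is, so the right side is
    symmetric too.\<close>
  then have "transpose (M ** G) ** (M ** G) = transpose (M ** G)"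
    by (metis matrix_mul_assoc matrix_transpose_mul)
  then have sym: "transpose (M ** G) = M ** G"
    by (metis matrix_transpose_mul transpose_transpose)
  then have "M ** G ** M = M"
    using normal by (metis matrix_transpose_mul transpose_transpose)
  with sym show ?thesis by blast
qed

text \<open>A {1,3}-inverse \<open>G\<close> and a {1,4}-inverse \<open>H\<close> combine to
  \<open>H ** M ** G\<close>, which satisfies all four Penrose conditions.\<close>

lemma ex_moore_penrose_inverse:
  fixes M :: "real^'n^'m"
  shows "\<exists>P. is_moore_penrose_inverse M P"
proof -
  obtain G where G: "M ** G ** M = M" "transpose (M ** G) = M ** G"
    using ex_13_inverse by blast
  obtain H' where H': "transpose M ** H' ** transpose M = transpose M"
    "transpose (transpose M ** H') = transpose M ** H'"
    using ex_13_inverse by blast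
  \<comment> \<open>Transposing turns a {1,3}-inverse of \<open>transpose M\<close> into a
    {1,4}-inverse of \<open>M\<close>.\<close>
  define H where "H = transpose H'"
  have H: "M ** H ** M = M" "transpose (H ** M) = H ** M"
    using H' unfolding H_def
    by (metis matrix_transpose_mul transpose_transpose matrix_mul_assoc)+
  \<comment> \<open>The two products with \<open>M\<close> collapse to \<open>M ** G\<close> and
    \<open>H ** M\<close>, whose symmetry is known.\<close>
  have "M ** (H ** M ** G) = M ** G" "H ** M ** G ** M = H ** M"
    using G(1) H(1) by (metis matrix_mul_assoc)+
  moreover from this have "H ** M ** G ** M ** (H ** M ** G) = H ** M ** G"
    using H(1) by (metis matrix_mul_assoc)
  ultimately have "is_moore_penrose_inverse M (H ** M ** G)"
    unfolding is_moore_penrose_inverse_def using G H by simp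
  then show ?thesis ..
qed

lemma is_moore_penrose_inverse_moore_penrose_inverse:
  "is_moore_penrose_inverse M (moore_penrose_inverse M)"
  unfolding moore_penrose_inverse_def
  using ex_moore_penrose_inverse is_moore_penrose_inverse_unique by (metis theI)

lemma matrix_diff_ldistrib:
  fixes M :: "'a::ring_1^'n^'m"
  shows "M ** (X - Y) = M ** X - M ** Y"
  by (simp add: matrix_matrix_mult_def vec_eq_iff sum_subtractf right_diff_distrib)

lemma matrix_diff_rdistrib:
  fixes X :: "'a::ring_1^'d^'n"
  shows "(M - N) ** X = M ** X - N ** X"
  by (simp add: matrix_matrix_mult_def vec_eq_iff sum_subtractf left_diff_distrib)

context
  fixes M :: "real^'n^'k" and P :: "real^'k^'n"
  assumes MP: "is_moore_penrose_inverse M P"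
begin

text \<open>The residual of \<open>P ** D\<close> satisfies the normal equations, hence is
  orthogonal to every \<open>M ** V\<close>.\<close>

lemma is_ls_solution_iff_moore_penrose:
  fixes D :: "real^'d^'k"
  shows "is_ls_solution M D X \<longleftrightarrow> M ** X = M ** (P ** D)"
proof -
  have "transpose M ** (M ** P) = transpose M"
    using MP unfolding is_moore_penrose_inverse_def by (metis matrix_transpose_mul)
  then have "transpose M ** (M ** (P ** D) - D) = 0"
    by (simp add: matrix_diff_ldistrib matrix_mul_assoc)
  then have orth: "inner (M ** (P ** D) - D) (M ** V) = 0" for V :: "real^'d^'n"
    by (simp add: inner_commute[of _ "M ** V"] inner_matrix_mult_left)
  \<comment> \<open>Split \<open>M ** Y - D\<close> as
    \<open>(M ** (P ** D) - D) + M ** (Y - P ** D)\<close>.\<close>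
  have less: "norm (M ** (P ** D) - D) < norm (M ** Y - D)" if "M ** Y \<noteq> M ** (P ** D)" for Y
    using norm_add_Pythagorean_less[OF orth[of "Y - P ** D"]] that
    by (simp add: matrix_diff_ldistrib)
  show ?thesis
    unfolding is_ls_solution_def frobenius_norm_eq_norm
    using less by (metis linorder_not_le order.strict_iff_order)
qed

text \<open>The left side says that \<open>X - P ** D\<close> is annihilated by \<open>M\<close>,
  and \<open>mat 1 - P ** M\<close> projects onto the kernel of \<open>M\<close>.\<close>

lemma moore_penrose_solution_set:
  "M ** X = M ** (P ** D) \<longleftrightarrow> (\<exists>Z. X = P ** D + (mat 1 - P ** M) ** Z)"
proof
  assume "M ** X = M ** (P ** D)"
  then have "P ** M ** X = P ** M ** P ** D"
    by (metis matrix_mul_assoc)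
  then have "P ** M ** X = P ** D"
    using MP by (simp add: is_moore_penrose_inverse_def)
  \<comment> \<open>The matrix \<open>X\<close> itself serves as \<open>Z\<close>.\<close>
  then have "X = P ** D + (mat 1 - P ** M) ** X"
    by (simp add: matrix_diff_rdistrib)
  then show "\<exists>Z. X = P ** D + (mat 1 - P ** M) ** Z" ..
next
  assume "\<exists>Z. X = P ** D + (mat 1 - P ** M) ** Z"
  moreover have "M ** (mat 1 - P ** M) = 0"
    using MP by (simp add: is_moore_penrose_inverse_def matrix_diff_ldistrib matrix_mul_assoc)
  ultimately show "M ** X = M ** (P ** D)"
    by (auto simp: matrix_add_ldistrib matrix_mul_assoc)
qed

lemma norm_moore_penrose_solution_less:
  assumes "M ** X = M ** (P ** D)" "X \<noteq> P ** D"
  shows "norm (P ** D) < norm X"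
proof -
  \<comment> \<open>So \<open>P ** D\<close> is fixed by the symmetric \<open>P ** M\<close>, which
    can be moved onto \<open>X - P ** D\<close> and annihilates it.\<close>
  have "P ** D = P ** M ** (P ** D)"
    using MP by (simp add: is_moore_penrose_inverse_def matrix_mul_assoc)
  then have "inner (P ** D) (X - P ** D) = inner (P ** M ** (P ** D)) (X - P ** D)"
    by simp
  also have "\<dots> = inner (P ** D) (P ** M ** (X - P ** D))"
    using MP by (simp add: is_moore_penrose_inverse_def inner_matrix_mult_left)
  also have "M ** (X - P ** D) = 0"
    using assms(1) by (simp add: matrix_diff_ldistrib)
  then have "P ** M ** (X - P ** D) = 0"
    by (simp flip: matrix_mul_assoc)
  finally show ?thesis
    using norm_add_Pythagorean_less[of "P ** D" "X - P ** D"] assms(2) by simp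
qed

end

lemma norm_power2_vec: "(norm x)\<^sup>2 = (\<Sum>i\<in>UNIV. (norm (x $ i))\<^sup>2)"
  by (simp add: norm_vec_def L2_set_def sum_nonneg)

lemma norm_vstack: "(norm (vstack M N))\<^sup>2 = (norm M)\<^sup>2 + (norm N)\<^sup>2"
  unfolding norm_power2_vec[of "vstack M N"] norm_power2_vec[of M] norm_power2_vec[of N]
  by (simp add: vstack_def sum.Plus flip: UNIV_Plus_UNIV)

text \<open>The norm of a reduced biquaternion is the Euclidean norm of its four components, so
  stacking only regroups the squares.\<close>

lemma norm_rb_stack: "norm (rb_stack M) = norm M"
proof -
  have "(norm (rb_stack M))\<^sup>2 = (norm M)\<^sup>2"
    unfolding rb_stack_def norm_vstack
    by (simp add: norm_power2_vec map_matrix_def norm_rbiq_def sum.distrib)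
  then show ?thesis by simp
qed

lemma vstack_diff: "vstack M N - vstack M' N' = vstack (M - M') (N - N')"
  by (simp add: vstack_def vec_eq_iff split: sum.split)

lemma rb_stack_diff: "rb_stack (M - N) = rb_stack M - rb_stack N"
  unfolding rb_stack_def vstack_diff
  by (intro arg_cong2[where f = vstack]) (simp_all add: map_matrix_def vec_eq_iff)

lemma vstack_mult: "vstack M N ** X = vstack (M ** X) (N ** X)"
  by (simp add: vstack_def matrix_matrix_mult_def vec_eq_iff split: sum.split)

lemma Rb_sum:
  "Rb0 (sum f S) = (\<Sum>x\<in>S. Rb0 (f x))" "Rb1 (sum f S) = (\<Sum>x\<in>S. Rb1 (f x))"
  "Rb2 (sum f S) = (\<Sum>x\<in>S. Rb2 (f x))" "Rb3 (sum f S) = (\<Sum>x\<in>S. Rb3 (f x))"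
  by (induction S rule: infinite_finite_induct; simp)+

text \<open>Here it matters that \<open>X\<close> is real: multiplication by a real number does not
  mix the four components.\<close>

lemma rb_stack_mult_of_real: "rb_stack (M ** map_matrix of_real X) = rb_stack M ** X"
  unfolding rb_stack_def vstack_mult
  by (intro arg_cong2[where f = vstack])
    (simp_all add: map_matrix_def matrix_matrix_mult_def vec_eq_iff Rb_sum)

lemma is_rbls_solution_iff: "is_rbls_solution A B X \<longleftrightarrow> is_ls_solution (rb_stack A) (rb_stack B) X"
proof -
  \<comment> \<open>Feasibility determines \<open>G\<close> as the residual, so minimising over
    pairs is minimising over the real matrix alone.\<close>
  have feasible: "rbls_feasible A B Y G \<longleftrightarrow> G = A ** map_matrix of_real Y - B" for Y G
    by (auto simp: rbls_feasible_def)
  have "frobenius_norm (A ** map_matrix of_real Y - B)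
      = frobenius_norm (rb_stack A ** Y - rb_stack B)" for Y
    unfolding frobenius_norm_eq_norm
    by (metis norm_rb_stack rb_stack_diff rb_stack_mult_of_real)
  then show ?thesis
    by (simp add: is_rbls_solution_def is_ls_solution_def feasible)
qed

theorem corollary3p8:
  fixes A :: "rbiq^'n^'m" and B :: "rbiq^'d^'m"
    and C :: "real^'n^('m + 'm + 'm + 'm)" and D :: "real^'d^('m + 'm + 'm + 'm)"
    and X :: "real^'d^'n"
  assumes "CARD('m) > CARD('n)" and "CARD('m) \<ge> CARD('n) + CARD('d)"
    and "C = rb_stack A" and "D = rb_stack B"
  shows "(is_rbls_solution A B X \<longleftrightarrow> is_ls_solution C D X) \<and>
         {Y. is_rbls_solution A B Y} =
           {moore_penrose_inverse C ** D + (mat 1 - moore_penrose_inverse C ** C) ** Z | Z. True} \<and>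
         ((is_rbls_solution A B X \<and>
             (\<forall>Y. is_rbls_solution A B Y \<longrightarrow> frobenius_norm X \<le> frobenius_norm Y)) \<longleftrightarrow>
           X = moore_penrose_inverse C ** D)"
proof -
  define P where "P = moore_penrose_inverse C"
  have P: "is_moore_penrose_inverse C P"
    unfolding P_def by (rule is_moore_penrose_inverse_moore_penrose_inverse)
  have ls: "is_rbls_solution A B Y \<longleftrightarrow> is_ls_solution C D Y" for Y
    using assms(3,4) by (simp add: is_rbls_solution_iff)
  have sol: "is_rbls_solution A B Y \<longleftrightarrow> C ** Y = C ** (P ** D)" for Y
    by (simp add: ls is_ls_solution_iff_moore_penrose[OF P])
  have least: "norm (P ** D) < norm Y" if "is_rbls_solution A B Y" "Y \<noteq> P ** D" for Y
    using norm_moore_penrose_solution_less[OF P] that sol by blast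
  show ?thesis
    unfolding P_def[symmetric] frobenius_norm_eq_norm
  proof (intro conjI)
    show "is_rbls_solution A B X \<longleftrightarrow> is_ls_solution C D X"
      by (rule ls)
    show "{Y. is_rbls_solution A B Y} = {P ** D + (mat 1 - P ** C) ** Z | Z. True}"
      by (simp add: sol moore_penrose_solution_set[OF P])
    show "(is_rbls_solution A B X \<and> (\<forall>Y. is_rbls_solution A B Y \<longrightarrow> norm X \<le> norm Y))
        \<longleftrightarrow> X = P ** D"
      \<comment> \<open>Strictness in \<open>least\<close> rules out any other solution of minimal
        norm.\<close>
      using least sol by (metis linorder_not_le order.strict_iff_order)
  qed
qed

end
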